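(* Let $n\geq 4$, let $R=\mathbb{Q}[x_1,\ldots,x_{n+2}]$, let $I_n=(x_1x_2,x_2x_3,\ldots,x_{n-1}x_n,x_nx_1)\subset R$ be the edge ideal of the $n$-cycle, let $J_n=(x_n,x_1)\cap\bigcap_{1\le i\le n-1}(x_i,x_{i+1})\subset R$ be the cover ideal of the $n$-cycle, and let $L_n=x_{n+1}I_n+x_{n+2}J_n\subset R$. Then $L_n^2$ is not integrally closed.
   Context: For an ideal $I$ of a commutative ring $R$, an element $f\in R$ is integral over $I$ if there is an equation $f^k+c_1f^{k-1}+\cdots+c_{k-1}f+c_k=0$ with $c_i\in I^i$. The set $\overline{I}$ of elements integral over $I$ is the integral closure of $I$, and $I$ is integrally closed if $I=\overline{I}$. *)

theory Defs
  imports Complex_Main "HOL-Algebra.Ideal_Product" "HOL-Library.Poly_Mapping"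
begin

text \<open>
  Monomials are finitely supported exponent functions \<open>nat \<Rightarrow>\<^sub>0 nat\<close>, so the type
  \<open>(nat \<Rightarrow>\<^sub>0 nat) \<Rightarrow>\<^sub>0 rat\<close> has infinitely many variables.  The ring
  \<open>\<rat>[x\<^sub>v. v \<in> V]\<close> is cut out by its carrier.
\<close>

type_synonym rat_mpoly = "(nat \<Rightarrow>\<^sub>0 nat) \<Rightarrow>\<^sub>0 rat"

definition mpoly_ring :: "nat set \<Rightarrow> rat_mpoly ring" where
  "mpoly_ring V =
     \<lparr> carrier = {p. \<forall>m \<in> Poly_Mapping.keys p. Poly_Mapping.keys m \<subseteq> V},
       mult = (*), one = 1, zero = 0, add = (+) \<rparr>"

definition X :: "nat \<Rightarrow> rat_mpoly" where
  "X i = Poly_Mapping.single (Poly_Mapping.single i 1) 1"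

lemma X_closed: "i \<in> V \<Longrightarrow> X i \<in> carrier (mpoly_ring V)"
  by (simp add: mpoly_ring_def X_def)

lemma cring_mpoly_ring: "cring (mpoly_ring V)"
proof (rule cringI)
  show "abelian_group (mpoly_ring V)"
  proof (rule abelian_groupI)
    fix p q assume "p \<in> carrier (mpoly_ring V)" "q \<in> carrier (mpoly_ring V)"
    then show "p \<oplus>\<^bsub>mpoly_ring V\<^esub> q \<in> carrier (mpoly_ring V)"
      using Poly_Mapping.keys_add[of p q] by (fastforce simp: mpoly_ring_def)
  next
    fix p assume "p \<in> carrier (mpoly_ring V)"
    then show "\<exists>q \<in> carrier (mpoly_ring V). q \<oplus>\<^bsub>mpoly_ring V\<^esub> p = \<zero>\<^bsub>mpoly_ring V\<^esub>"
      by (intro bexI[of _ "- p"]) (auto simp: mpoly_ring_def)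
  qed (auto simp: mpoly_ring_def add_ac)
next
  show "Group.comm_monoid (mpoly_ring V)"
  proof (rule comm_monoidI)
    fix p q assume pq: "p \<in> carrier (mpoly_ring V)" "q \<in> carrier (mpoly_ring V)"
    have "Poly_Mapping.keys m \<subseteq> V" if m: "m \<in> Poly_Mapping.keys (p * q)" for m
    proof -
      obtain a b where "m = a + b" "a \<in> Poly_Mapping.keys p" "b \<in> Poly_Mapping.keys q"
        using m Poly_Mapping.keys_mult[of p q] by blast
      then show ?thesis
        using pq Poly_Mapping.keys_add[of a b] by (fastforce simp: mpoly_ring_def)
    qed
    then show "p \<otimes>\<^bsub>mpoly_ring V\<^esub> q \<in> carrier (mpoly_ring V)"
      by (simp add: mpoly_ring_def)
  qed (auto simp: mpoly_ring_def mult_ac)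
qed (simp add: mpoly_ring_def distrib_right)

text \<open>
  \<open>I [^]\<^bsub>ideals_set R\<^esub> i\<close> is the \<open>i\<close>-th power of the ideal \<open>I\<close>: multiplication in
  \<^const>\<open>ideals_set\<close> is the product of ideals, with unit \<open>carrier R\<close>.
\<close>

definition integral_over_ideal :: "('a, 'b) ring_scheme \<Rightarrow> 'a set \<Rightarrow> 'a \<Rightarrow> bool" where
  "integral_over_ideal R I f \<longleftrightarrow>
     f \<in> carrier R \<and>
     (\<exists>k \<ge> (1::nat). \<exists>c :: nat \<Rightarrow> 'a.
        (\<forall>i \<in> {1..k}. c i \<in> I [^]\<^bsub>ideals_set R\<^esub> i) \<and>
        f [^]\<^bsub>R\<^esub> k \<oplus>\<^bsub>R\<^esub> (\<Oplus>\<^bsub>R\<^esub> i \<in> {1..k}. c i \<otimes>\<^bsub>R\<^esub> f [^]\<^bsub>R\<^esub> (k - i)) = \<zero>\<^bsub>R\<^esub>)"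

definition integral_closure :: "('a, 'b) ring_scheme \<Rightarrow> 'a set \<Rightarrow> 'a set" where
  "integral_closure R I = {f. integral_over_ideal R I f}"

definition integrally_closed_ideal :: "('a, 'b) ring_scheme \<Rightarrow> 'a set \<Rightarrow> bool" where
  "integrally_closed_ideal R I \<longleftrightarrow> I = integral_closure R I"

definition cycle_ring :: "nat \<Rightarrow> rat_mpoly ring" where
  "cycle_ring n = mpoly_ring {1..n + 2}"

definition cycle_edge_ideal :: "nat \<Rightarrow> rat_mpoly set" where
  "cycle_edge_ideal n =
     Idl\<^bsub>cycle_ring n\<^esub> ({X i \<otimes>\<^bsub>cycle_ring n\<^esub> X (i + 1) | i. i \<in> {1..n - 1}}
                       \<union> {X n \<otimes>\<^bsub>cycle_ring n\<^esub> X 1})"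

definition cycle_cover_ideal :: "nat \<Rightarrow> rat_mpoly set" where
  "cycle_cover_ideal n =
     Idl\<^bsub>cycle_ring n\<^esub> {X n, X 1} \<inter> (\<Inter>i \<in> {1..n - 1}. Idl\<^bsub>cycle_ring n\<^esub> {X i, X (i + 1)})"

text \<open>
  Here \<open>a <#\<^bsub>R\<^esub> I\<close> is the set \<open>{a \<otimes> f | f \<in> I}\<close>, i.e. the ideal \<open>aI\<close>, and
  \<open><+>\<^bsub>R\<^esub>\<close> is the sum of ideals.
\<close>

definition L_ideal :: "nat \<Rightarrow> rat_mpoly set" where
  "L_ideal n =
     (X (n + 1) <#\<^bsub>cycle_ring n\<^esub> cycle_edge_ideal n)
       <+>\<^bsub>cycle_ring n\<^esub> (X (n + 2) <#\<^bsub>cycle_ring n\<^esub> cycle_cover_ideal n)"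

end

theory Submission
  imports Defs
begin

text \<open>
  Put \<open>y = x\<^bsub>n+1\<^esub>\<close>, \<open>z = x\<^bsub>n+2\<^esub>\<close> and \<open>f = x\<^sub>1 \<cdots> x\<^sub>n y z\<close>.  With \<open>w = x\<^sub>5 \<cdots> x\<^sub>n\<close>,
  \<open>f\<^sup>2 = (y x\<^sub>1 x\<^sub>2) (z x\<^sub>1 x\<^sub>3 w) (y x\<^sub>3 x\<^sub>4) (z x\<^sub>2 x\<^sub>4 w)\<close>
  is a product of four elements of \<open>L\<close>, so \<open>f\<close> is integral over \<open>L\<^sup>2\<close>.  On the other hand, since \<open>f\<close>
  is squarefree, \<open>f \<in> L\<^sup>2\<close> would factor \<open>x\<^sub>1 \<cdots> x\<^sub>n\<close> as a multiple of an edge times a multiple of a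
  vertex cover; but the complement of an edge does not cover that edge.
\<close>

section \<open>Supports of polynomials and monomial ideals\<close>

lemma mpoly_ring_simps [simp]:
  "p \<otimes>\<^bsub>mpoly_ring V\<^esub> q = p * q" "p \<oplus>\<^bsub>mpoly_ring V\<^esub> q = p + q"
  "\<one>\<^bsub>mpoly_ring V\<^esub> = 1" "\<zero>\<^bsub>mpoly_ring V\<^esub> = 0"
  by (simp_all add: mpoly_ring_def)

lemma a_inv_mpoly_ring [simp]:
  assumes "p \<in> carrier (mpoly_ring V)"
  shows "\<ominus>\<^bsub>mpoly_ring V\<^esub> p = - p"
proof -
  interpret cring "mpoly_ring V" by (rule cring_mpoly_ring)
  have "- p \<in> carrier (mpoly_ring V)"
    using assms by (simp add: mpoly_ring_def)
  then show ?thesis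
    using assms minus_equality[of "- p" p] by simp
qed

text \<open>Multiplying by a polynomial only shifts exponents by monomials \<open>t\<close>, and
  addition creates no new monomials. With \<open>genideal_minimal\<close>, this bounds the supports
  of elements of a generated ideal by inspecting generators only.\<close>

lemma ideal_keys_upset:
  assumes up: "\<And>m t. m \<in> U \<Longrightarrow> t + m \<in> U"
  shows "ideal {p \<in> carrier (mpoly_ring V). Poly_Mapping.keys p \<subseteq> U} (mpoly_ring V)"
    (is "ideal ?I ?R")
proof -
  interpret cring ?R by (rule cring_mpoly_ring)
  have mult: "x * a \<in> ?I" if "a \<in> ?I" "x \<in> carrier ?R" for a x
    using that m_closed[of x a] Poly_Mapping.keys_mult[of x a] up by fastforce
  show ?thesis
  proof (rule idealI)
    show "subgroup ?I (add_monoid ?R)"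
    proof (rule add.subgroupI)
      fix a b assume ab: "a \<in> ?I" "b \<in> ?I"
      then show "a \<oplus>\<^bsub>?R\<^esub> b \<in> ?I"
        using Poly_Mapping.keys_add[of a b] a_closed[of a b] by auto
    next
      fix a assume "a \<in> ?I"
      then show "\<ominus>\<^bsub>?R\<^esub> a \<in> ?I" using a_inv_closed[of a] by simp
    next
      have "0 \<in> ?I" using zero_closed by simp
      then show "?I \<noteq> {}" by blast
    qed auto
  next
    fix a x assume "a \<in> ?I" "x \<in> carrier ?R"
    from mult[OF this] show "x \<otimes>\<^bsub>?R\<^esub> a \<in> ?I" "a \<otimes>\<^bsub>?R\<^esub> x \<in> ?I"
      by (simp_all add: mult.commute[of a x])
  qed (rule ring_axioms)
qed

section \<open>Squarefree monomials and ideals generated by variables\<close>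

lemma prod_X: "finite A \<Longrightarrow> prod X A = Poly_Mapping.single (\<Sum>i\<in>A. Poly_Mapping.single i 1) 1"
  by (induction A rule: finite_induct) (auto simp: X_def mult_single)

lemma lookup_sum_single:
  "finite A \<Longrightarrow> Poly_Mapping.lookup (\<Sum>i\<in>A. Poly_Mapping.single i (1::nat)) j = (if j \<in> A then 1 else 0)"
  by (induction A rule: finite_induct) (auto simp: lookup_add lookup_single when_def)

lemma keys_prod_X:
  "finite A \<Longrightarrow> Poly_Mapping.keys (prod X A) = {\<Sum>i\<in>A. Poly_Mapping.single i 1}"
  by (simp add: prod_X)

lemma prod_X_closed:
  assumes "A \<subseteq> V" "finite A"
  shows "prod X A \<in> carrier (mpoly_ring V)"
proof -
  have "Poly_Mapping.keys (\<Sum>i\<in>A. Poly_Mapping.single i (1::nat)) \<subseteq> V"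
    using assms lookup_sum_single[of A] by (auto simp: in_keys_iff split: if_splits)
  then show ?thesis
    using assms by (simp add: mpoly_ring_def keys_prod_X)
qed

lemma prod_X_in_genideal:
  assumes "A \<subseteq> V" "finite A" "i \<in> A" "X i \<in> S" "S \<subseteq> carrier (mpoly_ring V)"
  shows "prod X A \<in> Idl\<^bsub>mpoly_ring V\<^esub> S"
proof -
  interpret cring "mpoly_ring V" by (rule cring_mpoly_ring)
  have "prod X A = X i * prod X (A - {i})"
    using assms by (simp add: prod.remove)
  moreover have "prod X (A - {i}) \<in> carrier (mpoly_ring V)"
    using assms by (intro prod_X_closed) auto
  moreover have "X i \<in> Idl\<^bsub>mpoly_ring V\<^esub> S"
    using genideal_self assms by blast
  ultimately show ?thesis
    using ideal.I_r_closed[OF genideal_ideal[OF assms(5)]] by fastforce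
qed

lemma X_pair_closed: "{i, j} \<subseteq> V \<Longrightarrow> {X i, X j} \<subseteq> carrier (mpoly_ring V)"
  by (simp add: X_closed)

text \<open>Divisibility by one of two variables is an upward closed condition on monomials that
  both generators satisfy.\<close>

lemma keys_genideal_X_pair:
  assumes "{i, j} \<subseteq> V" "p \<in> Idl\<^bsub>mpoly_ring V\<^esub> {X i, X j}" "m \<in> Poly_Mapping.keys p"
  shows "Poly_Mapping.lookup m i > 0 \<or> Poly_Mapping.lookup m j > 0"
proof -
  interpret cring "mpoly_ring V" by (rule cring_mpoly_ring)
  let ?U = "{m. Poly_Mapping.lookup m i > 0 \<or> Poly_Mapping.lookup m j > (0::nat)}"
  have "Poly_Mapping.keys (X i) \<subseteq> ?U" "Poly_Mapping.keys (X j) \<subseteq> ?U"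
    by (simp_all add: X_def)
  then have "Idl\<^bsub>mpoly_ring V\<^esub> {X i, X j} \<subseteq> {p \<in> carrier (mpoly_ring V). Poly_Mapping.keys p \<subseteq> ?U}"
    using assms(1) X_closed[of i V] X_closed[of j V]
    by (intro genideal_minimal ideal_keys_upset) (simp_all add: lookup_add, argo)
  from subsetD[OF this assms(2)] have "m \<in> ?U"
    using assms(3) by auto
  then show ?thesis by simp
qed

section \<open>Explicit elements of \<open>L_ideal\<close>\<close>

lemma cycle_ring_ideals:
  assumes "n \<ge> 1"
  shows "ideal (cycle_edge_ideal n) (cycle_ring n)" "0 \<in> cycle_cover_ideal n"
proof -
  interpret cring "cycle_ring n" unfolding cycle_ring_def by (rule cring_mpoly_ring)
  show "ideal (cycle_edge_ideal n) (cycle_ring n)"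
    unfolding cycle_edge_ideal_def using assms
    by (intro genideal_ideal) (auto simp: cycle_ring_def X_closed intro!: m_closed[unfolded cycle_ring_def, simplified])
  have *: "0 \<in> Idl\<^bsub>cycle_ring n\<^esub> {X i, X j}" if "{i, j} \<subseteq> {1..n+2}" for i j
    using additive_subgroup.zero_closed[OF ideal.axioms(1)[OF genideal_ideal], of "{X i, X j}"] X_pair_closed[OF that]
    by (simp add: cycle_ring_def)
  then show "0 \<in> cycle_cover_ideal n"
    using assms unfolding cycle_cover_ideal_def by (intro IntI INT_I *) auto
qed

lemma X_mult_edge_in_L_ideal:
  assumes "n \<ge> 2" "i \<in> {1..n - 1}"
  shows "X (n + 1) * (X i * X (i + 1)) \<in> L_ideal n"
proof -
  interpret cring "cycle_ring n" unfolding cycle_ring_def by (rule cring_mpoly_ring)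
  let ?S = "{X i * X (i + 1) | i. i \<in> {1..n - 1}} \<union> {X n * X 1}"
  have "?S \<subseteq> carrier (cycle_ring n)"
    using assms by (auto simp: cycle_ring_def X_closed intro!: m_closed[unfolded cycle_ring_def, simplified])
  from genideal_self[OF this] have "X i * X (i + 1) \<in> cycle_edge_ideal n"
    using assms unfolding cycle_edge_ideal_def by (auto simp: cycle_ring_def)
  \<comment> \<open>The cover summand of the ideal sum is taken to be 0.\<close>
  then show ?thesis
    using cycle_ring_ideals(2)[of n] assms
    by (force simp: L_ideal_def set_add_defs l_coset_def cycle_ring_def)
qed

text \<open>The last two hypotheses say that \<open>A\<close> is a vertex cover of the cycle, so
  \<open>prod X A\<close> has a factor in each ideal of the intersection defining
  \<open>cycle_cover_ideal\<close>.\<close>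

lemma X_mult_cover_in_L_ideal:
  assumes "n \<ge> 2" "A \<subseteq> {1..n}" "1 \<in> A \<or> n \<in> A" "\<And>i. i \<in> {1..n - 1} \<Longrightarrow> i \<in> A \<or> i + 1 \<in> A"
  shows "X (n + 2) * prod X A \<in> L_ideal n"
proof -
  have "finite A" using assms(2) finite_subset by blast
  have *: "prod X A \<in> Idl\<^bsub>cycle_ring n\<^esub> {X i, X j}" if "i \<in> A \<or> j \<in> A" "{i, j} \<subseteq> {1..n+2}" for i j
  proof -
    have "A \<subseteq> {1..n+2}" using assms(2) by auto
    then show ?thesis
      using that \<open>finite A\<close> X_pair_closed[OF that(2)] unfolding cycle_ring_def
      by (blast intro: prod_X_in_genideal)
  qed
  have "prod X A \<in> cycle_cover_ideal n"
    unfolding cycle_cover_ideal_def using assms by (intro IntI INT_I *) auto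
  moreover have "0 \<in> cycle_edge_ideal n"
    using additive_subgroup.zero_closed[OF ideal.axioms(1)[OF cycle_ring_ideals(1)[of n]]] assms
    by (simp add: cycle_ring_def)
  ultimately show ?thesis
    by (force simp: L_ideal_def set_add_defs l_coset_def cycle_ring_def)
qed

section \<open>Monomials occurring in the edge ideal, the cover ideal and
  \<open>L_ideal\<close>\<close>

definition cycle_edges :: "nat \<Rightarrow> (nat \<times> nat) set" where
  "cycle_edges n = {(i, i + 1) | i. i \<in> {1..n - 1}} \<union> {(n, 1)}"

text \<open>Divisibility by some edge monomial is upward closed and holds for every generator, so
  \<open>ideal_keys_upset\<close> applies.\<close>

lemma keys_cycle_edge_ideal:
  assumes "n \<ge> 1" "p \<in> cycle_edge_ideal n" "m \<in> Poly_Mapping.keys p"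
  shows "\<exists>i j. (i, j) \<in> cycle_edges n \<and> Poly_Mapping.lookup m i > 0 \<and> Poly_Mapping.lookup m j > 0"
proof -
  interpret cring "mpoly_ring {1..n+2}" by (rule cring_mpoly_ring)
  let ?U = "{m. \<exists>i j. (i, j) \<in> cycle_edges n \<and> Poly_Mapping.lookup m i > 0 \<and> Poly_Mapping.lookup m j > (0::nat)}"
  have "X i * X j \<in> {p \<in> carrier (mpoly_ring {1..n+2}). Poly_Mapping.keys p \<subseteq> ?U}"
    if "(i, j) \<in> cycle_edges n" for i j
  proof -
    have "X i * X j \<in> carrier (mpoly_ring {1..n+2})"
      using that assms(1) m_closed[of "X i" "X j"] by (auto simp: cycle_edges_def X_closed)
    moreover have "Poly_Mapping.keys (X i * X j) \<subseteq> ?U"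
    proof -
      have "Poly_Mapping.single i 1 + Poly_Mapping.single j 1 \<in> ?U"
        unfolding mem_Collect_eq using that
        by (intro exI[of _ i] exI[of _ j]) (simp add: lookup_add)
      then show ?thesis by (simp add: X_def mult_single)
    qed
    ultimately show ?thesis by blast
  qed
  then have gens: "{X i * X (i + 1) | i. i \<in> {1..n - 1}} \<union> {X n * X 1}
      \<subseteq> {p \<in> carrier (mpoly_ring {1..n+2}). Poly_Mapping.keys p \<subseteq> ?U}"
    unfolding cycle_edges_def by blast
  have "ideal {p \<in> carrier (mpoly_ring {1..n+2}). Poly_Mapping.keys p \<subseteq> ?U} (mpoly_ring {1..n+2})"
  proof (rule ideal_keys_upset)
    fix m t assume "m \<in> ?U"
    then show "t + m \<in> ?U" by (simp add: lookup_add) blast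
  qed
  from genideal_minimal[OF this gens] have "p \<in> {p \<in> carrier (mpoly_ring {1..n+2}). Poly_Mapping.keys p \<subseteq> ?U}"
    using assms(2) by (auto simp: cycle_edge_ideal_def cycle_ring_def)
  then show ?thesis using assms(3) by blast
qed

lemma keys_cycle_cover_ideal:
  assumes "n \<ge> 1" "p \<in> cycle_cover_ideal n" "m \<in> Poly_Mapping.keys p" "(i, j) \<in> cycle_edges n"
  shows "Poly_Mapping.lookup m i > 0 \<or> Poly_Mapping.lookup m j > 0"
proof (rule keys_genideal_X_pair)
  show "{i, j} \<subseteq> {1..n+2}" using assms by (auto simp: cycle_edges_def)
  show "p \<in> Idl\<^bsub>mpoly_ring {1..n+2}\<^esub> {X i, X j}"
    using assms by (auto simp: cycle_edges_def cycle_cover_ideal_def cycle_ring_def)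
qed fact

lemma keys_X_mult:
  assumes "m \<in> Poly_Mapping.keys (X i * p)"
  obtains t where "t \<in> Poly_Mapping.keys p" "m = Poly_Mapping.single i 1 + t"
proof -
  obtain a t where "m = a + t" "a \<in> Poly_Mapping.keys (X i)" "t \<in> Poly_Mapping.keys p"
    using subsetD[OF Poly_Mapping.keys_mult assms] by blast
  then show thesis
    using that by (simp add: X_def)
qed

text \<open>A monomial of a sum occurs in one of the summands, so it inherits either the edge type
  or the cover type. This dichotomy drives the case analysis for the square.\<close>

lemma keys_L_ideal:
  assumes "n \<ge> 1" "p \<in> L_ideal n" "m \<in> Poly_Mapping.keys p"
  shows "Poly_Mapping.lookup m (n + 1) > 0 \<and>
           (\<exists>i j. (i, j) \<in> cycle_edges n \<and> Poly_Mapping.lookup m i > 0 \<and> Poly_Mapping.lookup m j > 0) \<or>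
         Poly_Mapping.lookup m (n + 2) > 0 \<and>
           (\<forall>i j. (i, j) \<in> cycle_edges n \<longrightarrow> Poly_Mapping.lookup m i > 0 \<or> Poly_Mapping.lookup m j > 0)"
proof -
  obtain a b where ab: "a \<in> cycle_edge_ideal n" "b \<in> cycle_cover_ideal n" "p = X (n + 1) * a + X (n + 2) * b"
    using assms(2) by (auto simp: L_ideal_def set_add_defs l_coset_def cycle_ring_def)
  have "m \<in> Poly_Mapping.keys (X (n + 1) * a) \<or> m \<in> Poly_Mapping.keys (X (n + 2) * b)"
    using subsetD[OF Poly_Mapping.keys_add assms(3)[unfolded ab(3)]] by blast
  then show ?thesis
  proof
    assume "m \<in> Poly_Mapping.keys (X (n + 1) * a)"
    then obtain t where "t \<in> Poly_Mapping.keys a" "m = Poly_Mapping.single (n + 1) 1 + t"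
      by (rule keys_X_mult)
    then show ?thesis
      using keys_cycle_edge_ideal[OF assms(1) ab(1), of t] by (simp add: lookup_add) blast
  next
    assume "m \<in> Poly_Mapping.keys (X (n + 2) * b)"
    then obtain t where "t \<in> Poly_Mapping.keys b" "m = Poly_Mapping.single (n + 2) 1 + t"
      by (rule keys_X_mult)
    then have "Poly_Mapping.lookup m (n + 2) > 0"
        "(i, j) \<in> cycle_edges n \<Longrightarrow> Poly_Mapping.lookup m i > 0 \<or> Poly_Mapping.lookup m j > 0" for i j
      using keys_cycle_cover_ideal[OF assms(1) ab(2), of t i j] by (auto simp: lookup_add)
    then show ?thesis by blast
  qed
qed

section \<open>Products of ideals and nonmembership in the square\<close>

lemma keys_ideal_prod:
  assumes "p \<in> I \<cdot>\<^bsub>mpoly_ring V\<^esub> J" "m \<in> Poly_Mapping.keys p"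
  shows "\<exists>q\<in>I. \<exists>r\<in>J. \<exists>a \<in> Poly_Mapping.keys q. \<exists>b \<in> Poly_Mapping.keys r. m = a + b"
  using assms
proof (induction arbitrary: m rule: ideal_prod.induct)
  case (prod i j)
  then have "m \<in> Poly_Mapping.keys (i * j)" by simp
  from subsetD[OF Poly_Mapping.keys_mult this] show ?case
    using prod by blast
next
  case (sum s1 s2)
  then have "m \<in> Poly_Mapping.keys (s1 + s2)" by simp
  from subsetD[OF Poly_Mapping.keys_add this] show ?case
    using sum.IH by blast
qed

text \<open>The recursion for powers starts at the unit \<open>carrier R\<close>, hence the extra
  leading factor.\<close>

lemma ideals_set_pow_2:
  "I [^]\<^bsub>ideals_set R\<^esub> (2::nat) = (carrier R \<cdot>\<^bsub>R\<^esub> I) \<cdot>\<^bsub>R\<^esub> I"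
  by (simp add: nat_pow_def numeral_2_eq_2 ideals_set_def)

lemma ideals_set_pow_1: "I [^]\<^bsub>ideals_set R\<^esub> (1::nat) = carrier R \<cdot>\<^bsub>R\<^esub> I"
  by (simp add: nat_pow_def ideals_set_def)

lemma squarefree_notin_L_ideal_square:
  assumes "n \<ge> 1"
  shows "prod X {1..n+2} \<notin> L_ideal n [^]\<^bsub>ideals_set (cycle_ring n)\<^esub> (2::nat)"
proof
  define e where "e = (\<Sum>i\<in>{1..n+2}. Poly_Mapping.single i (1::nat))"
  have e_key: "e \<in> Poly_Mapping.keys (prod X {1..n+2})"
    unfolding e_def by (subst keys_prod_X) auto
  assume "prod X {1..n+2} \<in> L_ideal n [^]\<^bsub>ideals_set (cycle_ring n)\<^esub> (2::nat)"
  from keys_ideal_prod[OF this[unfolded ideals_set_pow_2 cycle_ring_def] e_key]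
  obtain r c d s where rs: "r \<in> carrier (mpoly_ring {1..n+2}) \<cdot>\<^bsub>mpoly_ring {1..n+2}\<^esub> L_ideal n"
      "s \<in> L_ideal n" "c \<in> Poly_Mapping.keys r" "d \<in> Poly_Mapping.keys s" "e = c + d"
    by blast
  from keys_ideal_prod[OF rs(1,3)]
  obtain q a t where q: "q \<in> L_ideal n" "a \<in> Poly_Mapping.keys q" "c = t + a"
    by blast
  \<comment> \<open>Here \<open>a\<close> and \<open>d\<close> are monomials of elements of
    \<open>L_ideal\<close>, and \<open>t\<close> comes from the leading carrier factor.
    Squarefreeness of \<open>e = t + a + d\<close> forces \<open>a\<close> and \<open>d\<close> to
    have disjoint supports.\<close>
  have e: "Poly_Mapping.lookup t j + Poly_Mapping.lookup a j + Poly_Mapping.lookup d j \<le> 1" for j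
  proof -
    have "Poly_Mapping.lookup e j \<le> 1"
      unfolding e_def by (subst lookup_sum_single) auto
    then show ?thesis by (simp add: rs q lookup_add)
  qed
  have "\<not> (Poly_Mapping.lookup a j > 0 \<and> Poly_Mapping.lookup d j > 0)" for j
    using e[of j] by auto
  \<comment> \<open>Two monomials of edge type share the variable \<open>n + 1\<close>, and two of
    cover type share \<open>n + 2\<close>. In the mixed case the cover monomial contains an endpoint
    of the edge dividing the other one.\<close>
  then show False
    using keys_L_ideal[OF assms q(1,2)] keys_L_ideal[OF assms rs(2,4)]
    by blast
qed

section \<open>Integrality of the squarefree monomial\<close>

lemma squarefree_integral_over_L_ideal_square:
  assumes "n \<ge> 4"
  shows "integral_over_ideal (cycle_ring n)
           (L_ideal n [^]\<^bsub>ideals_set (cycle_ring n)\<^esub> (2::nat)) (prod X {1..n+2})"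
proof -
  define R where "R = cycle_ring n"
  have R: "R = mpoly_ring {1..n+2}" by (simp add: R_def cycle_ring_def)
  interpret cring R unfolding R by (rule cring_mpoly_ring)
  define L2 where "L2 = L_ideal n [^]\<^bsub>ideals_set R\<^esub> (2::nat)"
  define f where "f = prod X {1..n+2}"
  \<comment> \<open>Both \<open>A\<close> and \<open>B\<close> are vertex covers of the cycle. They
    split the vertices 1 to 4 between them and share all the remaining ones.\<close>
  define A where "A = {1,3} \<union> {5..n}"
  define B where "B = {2,4} \<union> {5..n}"
  \<comment> \<open>Each of \<open>g1\<close> and \<open>g2\<close> pairs an edge element with a
    cover element. The edges 12 and 34 supply each of the vertices 1 to 4 a second time, so every
    variable has exponent 2 in \<open>g1 * g2\<close>.\<close>
  define g1 where "g1 = X (n+1) * (X 1 * X 2) * (X (n+2) * prod X A)"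
  define g2 where "g2 = X (n+1) * (X 3 * X 4) * (X (n+2) * prod X B)"
  have V: "{1..n+2} = {1,2,3,4} \<union> {5..n} \<union> {n+1,n+2}" using assms by auto
  have "f = prod X ({1,2,3,4} \<union> {5..n}) * prod X {n+1,n+2}"
    unfolding f_def V using assms by (intro prod.union_disjoint) auto
  also have "prod X ({1,2,3,4} \<union> {5..n}) = prod X {1,2,3,4} * prod X {5..n}"
    by (intro prod.union_disjoint) auto
  finally have f: "f = X 1 * X 2 * X 3 * X 4 * prod X {5..n} * X (n+1) * X (n+2)"
    by (simp add: mult_ac)
  have ff: "f * f = g1 * g2"
    unfolding f g1_def g2_def A_def B_def by (simp add: mult_ac)
  have fc: "f \<in> carrier R" unfolding f_def R by (intro prod_X_closed) auto
  have L2I: "p * q \<in> L2" if "p \<in> L_ideal n" "q \<in> L_ideal n" for p q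
  proof -
    \<comment> \<open>The factor 1 fills the leading carrier slot of the power.\<close>
    have "1 * p \<in> carrier R \<cdot>\<^bsub>R\<^esub> L_ideal n"
      using ideal_prod.prod[of 1 "carrier R" p "L_ideal n" R] that one_closed by (simp add: R)
    then show ?thesis
      unfolding L2_def ideals_set_pow_2 using ideal_prod.prod[of p _ q "L_ideal n" R] that by (simp add: R)
  qed
  have edge: "X (n+1) * (X 1 * X 2) \<in> L_ideal n" "X (n+1) * (X 3 * X 4) \<in> L_ideal n"
    using X_mult_edge_in_L_ideal[of n 1] X_mult_edge_in_L_ideal[of n 3] assms
    by (simp_all add: numeral_eq_Suc)
  have cover: "X (n+2) * prod X A \<in> L_ideal n" "X (n+2) * prod X B \<in> L_ideal n"
    using assms by (intro X_mult_cover_in_L_ideal; auto simp: A_def B_def)+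
  have g: "g1 \<in> L2" "g2 \<in> L2"
    unfolding g1_def g2_def by (intro L2I edge cover)+
  have m1: "- 1 \<in> carrier R" using a_inv_closed[OF one_closed] one_closed by (simp add: R)
  have c1: "0 \<in> L2 [^]\<^bsub>ideals_set R\<^esub> (1::nat)"
    unfolding ideals_set_pow_1
    using ideal_prod.prod[of 0 "carrier R" g1 L2 R] g zero_closed by (simp add: R)
  \<comment> \<open>The sign needed for the constant coefficient is absorbed by the carrier slot, as
    the factor -1.\<close>
  have "- g1 \<in> carrier R \<cdot>\<^bsub>R\<^esub> L2"
    using ideal_prod.prod[of "- 1" "carrier R" g1 L2 R] g m1 by (simp add: R)
  then have c2: "- (f * f) \<in> L2 [^]\<^bsub>ideals_set R\<^esub> (2::nat)"
    unfolding ideals_set_pow_2 ff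
    using ideal_prod.prod[of "- g1" _ g2 L2 R] g by (simp add: R)
  have ffc: "- (f * f) \<in> carrier R"
    using a_inv_closed[OF m_closed[OF fc fc]] m_closed[OF fc fc] by (simp add: R)
  \<comment> \<open>The integral equation has degree 2: \<open>f\<close> is a root of T^2 + 0 T -
    f^2, whose constant term - f^2 = - g1 g2 lies in the square of \<open>L2\<close>.\<close>
  define c where "c i = (if i = 1 then 0 else - (f * f))" for i :: nat
  have set: "{1..2} = {1, 2::nat}" by auto
  have sq: "f [^]\<^bsub>R\<^esub> (2::nat) = f * f"
    using fc by (simp add: numeral_2_eq_2 R nat_pow_def)
  define h where "h i = c i \<otimes>\<^bsub>R\<^esub> f [^]\<^bsub>R\<^esub> (2 - i)" for i
  have h: "h 1 = \<zero>\<^bsub>R\<^esub>" "h 2 = - (f * f)"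
    by (simp_all add: h_def c_def R nat_pow_def)
  have "(\<Oplus>\<^bsub>R\<^esub> i \<in> {1, 2}. h i) = - (f * f)"
    using h ffc by simp
  then have "(\<Oplus>\<^bsub>R\<^esub> i \<in> {1..2}. c i \<otimes>\<^bsub>R\<^esub> f [^]\<^bsub>R\<^esub> (2 - i)) = - (f * f)"
    unfolding set h_def .
  then have "f [^]\<^bsub>R\<^esub> (2::nat) \<oplus>\<^bsub>R\<^esub> (\<Oplus>\<^bsub>R\<^esub> i \<in> {1..2}. c i \<otimes>\<^bsub>R\<^esub> f [^]\<^bsub>R\<^esub> (2 - i)) = \<zero>\<^bsub>R\<^esub>"
    by (simp add: sq) (simp add: R)
  moreover have "\<forall>i\<in>{1..2}. c i \<in> L2 [^]\<^bsub>ideals_set R\<^esub> i"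
    unfolding set using c1 c2 by (auto simp: c_def)
  ultimately have "integral_over_ideal R L2 f"
    unfolding integral_over_ideal_def using fc by (intro conjI exI[of _ 2] exI[of _ c]) auto
  then show ?thesis by (simp add: R_def L2_def f_def)
qed

theorem theorem4p1:
  fixes n :: nat
  assumes "n \<ge> 4"
  shows "\<not> integrally_closed_ideal (cycle_ring n) (L_ideal n [^]\<^bsub>ideals_set (cycle_ring n)\<^esub> (2::nat))"
  using squarefree_integral_over_L_ideal_square[OF assms] squarefree_notin_L_ideal_square[of n] assms
  unfolding integrally_closed_ideal_def integral_closure_def by auto

end
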